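(* Let $E$ be an $M_2$-stable functor from $\mathrm{Alg}_H$ to an abelian category, $B$ an $H$-algebra, $A\subset B$ a subalgebra, and $V,W\in B$ elements such that $$WA\subset A,\quad AV\subset A,\quad aVWa'=aa'\ \ (a,a'\in A),\quad [V,h]=[W,h]=0\ \ (h\in H).$$ Then $$\phi^{V,W}:A\to A,\qquad a\mapsto WaV$$ is an $H$-algebra homomorphism, and $E(\phi^{V,W})=1_{E(A)}$.
   Context: $H$ is a fixed unital, not necessarily commutative ring. An $H$-algebra is a monoid, possibly without unit, in the monoidal category of $H$-bimodules with $\otimes_H$; $\mathrm{Alg}_H$ is the category of all $H$-algebras or, if $H$ is commutative, that of central ones (a fixed choice). A functor $E$ from $\mathrm{Alg}_H$ to an abelian category is $M_2$-stable if for every $A\in\mathrm{Alg}_H$ the map $E(A)\to E(M_2A)$ induced by the upper left corner inclusion $A\to M_2A$ is an isomorphism, where $M_2A=M_2(\mathbb Z)\otimes_{\mathbb Z}A$. *)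

theory Defs
  imports "HOL-Algebra.Ring"
begin

text \<open>
  Arrows are indexed by their source and target, so hom-sets need not be disjoint.
  \<open>cmp C X Y Z g f\<close> is the composite of \<open>f : X \<rightarrow> Y\<close> followed by \<open>g : Y \<rightarrow> Z\<close>.
\<close>

record ('o, 'm) category =
  obj :: "'o set"
  homs :: "'o \<Rightarrow> 'o \<Rightarrow> 'm set"
  ident :: "'o \<Rightarrow> 'm"
  cmp :: "'o \<Rightarrow> 'o \<Rightarrow> 'o \<Rightarrow> 'm \<Rightarrow> 'm \<Rightarrow> 'm"

locale category =
  fixes C :: "('o, 'm) category"
  assumes ident_in: "X \<in> obj C \<Longrightarrow> ident C X \<in> homs C X X"
    and cmp_in: "\<lbrakk>X \<in> obj C; Y \<in> obj C; Z \<in> obj C; f \<in> homs C X Y; g \<in> homs C Y Z\<rbrakk>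
      \<Longrightarrow> cmp C X Y Z g f \<in> homs C X Z"
    and cmp_ident_left: "\<lbrakk>X \<in> obj C; Y \<in> obj C; f \<in> homs C X Y\<rbrakk>
      \<Longrightarrow> cmp C X Y Y (ident C Y) f = f"
    and cmp_ident_right: "\<lbrakk>X \<in> obj C; Y \<in> obj C; f \<in> homs C X Y\<rbrakk>
      \<Longrightarrow> cmp C X X Y f (ident C X) = f"
    and cmp_assoc: "\<lbrakk>X \<in> obj C; Y \<in> obj C; Z \<in> obj C; T \<in> obj C;
        f \<in> homs C X Y; g \<in> homs C Y Z; h \<in> homs C Z T\<rbrakk>
      \<Longrightarrow> cmp C X Z T h (cmp C X Y Z g f) = cmp C X Y T (cmp C Y Z T h g) f"

definition is_iso :: "('o, 'm) category \<Rightarrow> 'o \<Rightarrow> 'o \<Rightarrow> 'm \<Rightarrow> bool" where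
  "is_iso C X Y f \<longleftrightarrow> f \<in> homs C X Y \<and>
     (\<exists>g \<in> homs C Y X. cmp C X Y X g f = ident C X \<and> cmp C Y X Y f g = ident C Y)"

definition is_mono :: "('o, 'm) category \<Rightarrow> 'o \<Rightarrow> 'o \<Rightarrow> 'm \<Rightarrow> bool" where
  "is_mono C X Y f \<longleftrightarrow> f \<in> homs C X Y \<and>
     (\<forall>T \<in> obj C. \<forall>u \<in> homs C T X. \<forall>v \<in> homs C T X.
        cmp C T X Y f u = cmp C T X Y f v \<longrightarrow> u = v)"

definition is_epi :: "('o, 'm) category \<Rightarrow> 'o \<Rightarrow> 'o \<Rightarrow> 'm \<Rightarrow> bool" where
  "is_epi C X Y f \<longleftrightarrow> f \<in> homs C X Y \<and>
     (\<forall>T \<in> obj C. \<forall>u \<in> homs C Y T. \<forall>v \<in> homs C Y T.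
        cmp C X Y T u f = cmp C X Y T v f \<longrightarrow> u = v)"

definition is_zero_object :: "('o, 'm) category \<Rightarrow> 'o \<Rightarrow> bool" where
  "is_zero_object C Z \<longleftrightarrow> Z \<in> obj C \<and>
     (\<forall>X \<in> obj C. (\<exists>!f. f \<in> homs C X Z) \<and> (\<exists>!f. f \<in> homs C Z X))"

definition is_zero_arrow :: "('o, 'm) category \<Rightarrow> 'o \<Rightarrow> 'o \<Rightarrow> 'm \<Rightarrow> bool" where
  "is_zero_arrow C X Y f \<longleftrightarrow>
     (\<exists>Z. is_zero_object C Z \<and> (\<exists>g \<in> homs C X Z. \<exists>h \<in> homs C Z Y. f = cmp C X Z Y h g))"

definition is_product :: "('o, 'm) category \<Rightarrow> 'o \<Rightarrow> 'o \<Rightarrow> 'o \<Rightarrow> 'm \<Rightarrow> 'm \<Rightarrow> bool" where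
  "is_product C X Y P p q \<longleftrightarrow> P \<in> obj C \<and> p \<in> homs C P X \<and> q \<in> homs C P Y \<and>
     (\<forall>T \<in> obj C. \<forall>f \<in> homs C T X. \<forall>g \<in> homs C T Y.
        \<exists>!u. u \<in> homs C T P \<and> cmp C T P X p u = f \<and> cmp C T P Y q u = g)"

definition is_coproduct :: "('o, 'm) category \<Rightarrow> 'o \<Rightarrow> 'o \<Rightarrow> 'o \<Rightarrow> 'm \<Rightarrow> 'm \<Rightarrow> bool" where
  "is_coproduct C X Y S i j \<longleftrightarrow> S \<in> obj C \<and> i \<in> homs C X S \<and> j \<in> homs C Y S \<and>
     (\<forall>T \<in> obj C. \<forall>f \<in> homs C X T. \<forall>g \<in> homs C Y T.
        \<exists>!u. u \<in> homs C S T \<and> cmp C X S T u i = f \<and> cmp C Y S T u j = g)"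

definition is_kernel :: "('o, 'm) category \<Rightarrow> 'o \<Rightarrow> 'o \<Rightarrow> 'm \<Rightarrow> 'o \<Rightarrow> 'm \<Rightarrow> bool" where
  "is_kernel C X Y f K k \<longleftrightarrow> K \<in> obj C \<and> k \<in> homs C K X \<and>
     is_zero_arrow C K Y (cmp C K X Y f k) \<and>
     (\<forall>T \<in> obj C. \<forall>t \<in> homs C T X. is_zero_arrow C T Y (cmp C T X Y f t) \<longrightarrow>
        (\<exists>!u. u \<in> homs C T K \<and> cmp C T K X k u = t))"

definition is_cokernel :: "('o, 'm) category \<Rightarrow> 'o \<Rightarrow> 'o \<Rightarrow> 'm \<Rightarrow> 'o \<Rightarrow> 'm \<Rightarrow> bool" where
  "is_cokernel C X Y f Q q \<longleftrightarrow> Q \<in> obj C \<and> q \<in> homs C Y Q \<and>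
     is_zero_arrow C X Q (cmp C X Y Q q f) \<and>
     (\<forall>T \<in> obj C. \<forall>t \<in> homs C Y T. is_zero_arrow C X T (cmp C X Y T t f) \<longrightarrow>
        (\<exists>!u. u \<in> homs C Q T \<and> cmp C Y Q T u q = t))"

text \<open>
  Freyd's axioms; the abelian group structure on hom-sets is determined by them
  and is therefore not part of the data.
\<close>

locale abelian_category = category C for C :: "('o, 'm) category" +
  assumes zero_object: "\<exists>Z. is_zero_object C Z"
    and products: "\<lbrakk>X \<in> obj C; Y \<in> obj C\<rbrakk> \<Longrightarrow> \<exists>P p q. is_product C X Y P p q"
    and coproducts: "\<lbrakk>X \<in> obj C; Y \<in> obj C\<rbrakk> \<Longrightarrow> \<exists>S i j. is_coproduct C X Y S i j"
    and kernels: "\<lbrakk>X \<in> obj C; Y \<in> obj C; f \<in> homs C X Y\<rbrakk> \<Longrightarrow> \<exists>K k. is_kernel C X Y f K k"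
    and cokernels: "\<lbrakk>X \<in> obj C; Y \<in> obj C; f \<in> homs C X Y\<rbrakk> \<Longrightarrow> \<exists>Q q. is_cokernel C X Y f Q q"
    and monos_normal: "\<lbrakk>X \<in> obj C; Y \<in> obj C; is_mono C X Y f\<rbrakk>
      \<Longrightarrow> \<exists>T g. T \<in> obj C \<and> g \<in> homs C Y T \<and> is_kernel C Y T g X f"
    and epis_normal: "\<lbrakk>X \<in> obj C; Y \<in> obj C; is_epi C X Y f\<rbrakk>
      \<Longrightarrow> \<exists>T g. T \<in> obj C \<and> g \<in> homs C T X \<and> is_cokernel C T X g Y f"

locale covariant_functor =
  fixes C :: "('o, 'm) category" and D :: "('p, 'n) category"
    and Fo :: "'o \<Rightarrow> 'p" and Fm :: "'o \<Rightarrow> 'o \<Rightarrow> 'm \<Rightarrow> 'n"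
  assumes obj_in: "X \<in> obj C \<Longrightarrow> Fo X \<in> obj D"
    and arr_in: "\<lbrakk>X \<in> obj C; Y \<in> obj C; f \<in> homs C X Y\<rbrakk> \<Longrightarrow> Fm X Y f \<in> homs D (Fo X) (Fo Y)"
    and map_ident: "X \<in> obj C \<Longrightarrow> Fm X X (ident C X) = ident D (Fo X)"
    and map_cmp: "\<lbrakk>X \<in> obj C; Y \<in> obj C; Z \<in> obj C; f \<in> homs C X Y; g \<in> homs C Y Z\<rbrakk>
      \<Longrightarrow> Fm X Z (cmp C X Y Z g f) = cmp D (Fo X) (Fo Y) (Fo Z) (Fm Y Z g) (Fm X Y f)"


text \<open>
  Algebras need not be unital: the field \<open>one\<close> inherited from the ring record is
  never constrained and carries no information.
\<close>

record ('h, 'a) halg = "'a ring" +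
  lact :: "'h \<Rightarrow> 'a \<Rightarrow> 'a"
  ract :: "'a \<Rightarrow> 'h \<Rightarrow> 'a"

locale bimodule = H: ring H + M: abelian_group M
  for H :: "'h ring" and M :: "('h, 'a) halg" +
  assumes lact_closed: "\<lbrakk>h \<in> carrier H; x \<in> carrier M\<rbrakk> \<Longrightarrow> lact M h x \<in> carrier M"
    and lact_add_left: "\<lbrakk>h \<in> carrier H; k \<in> carrier H; x \<in> carrier M\<rbrakk>
      \<Longrightarrow> lact M (h \<oplus>\<^bsub>H\<^esub> k) x = lact M h x \<oplus>\<^bsub>M\<^esub> lact M k x"
    and lact_add_right: "\<lbrakk>h \<in> carrier H; x \<in> carrier M; y \<in> carrier M\<rbrakk>
      \<Longrightarrow> lact M h (x \<oplus>\<^bsub>M\<^esub> y) = lact M h x \<oplus>\<^bsub>M\<^esub> lact M h y"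
    and lact_mult: "\<lbrakk>h \<in> carrier H; k \<in> carrier H; x \<in> carrier M\<rbrakk>
      \<Longrightarrow> lact M (h \<otimes>\<^bsub>H\<^esub> k) x = lact M h (lact M k x)"
    and lact_one: "x \<in> carrier M \<Longrightarrow> lact M \<one>\<^bsub>H\<^esub> x = x"
    and ract_closed: "\<lbrakk>h \<in> carrier H; x \<in> carrier M\<rbrakk> \<Longrightarrow> ract M x h \<in> carrier M"
    and ract_add_left: "\<lbrakk>h \<in> carrier H; x \<in> carrier M; y \<in> carrier M\<rbrakk>
      \<Longrightarrow> ract M (x \<oplus>\<^bsub>M\<^esub> y) h = ract M x h \<oplus>\<^bsub>M\<^esub> ract M y h"
    and ract_add_right: "\<lbrakk>h \<in> carrier H; k \<in> carrier H; x \<in> carrier M\<rbrakk>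
      \<Longrightarrow> ract M x (h \<oplus>\<^bsub>H\<^esub> k) = ract M x h \<oplus>\<^bsub>M\<^esub> ract M x k"
    and ract_mult: "\<lbrakk>h \<in> carrier H; k \<in> carrier H; x \<in> carrier M\<rbrakk>
      \<Longrightarrow> ract M x (h \<otimes>\<^bsub>H\<^esub> k) = ract M (ract M x h) k"
    and ract_one: "x \<in> carrier M \<Longrightarrow> ract M x \<one>\<^bsub>H\<^esub> = x"
    and lact_ract: "\<lbrakk>h \<in> carrier H; k \<in> carrier H; x \<in> carrier M\<rbrakk>
      \<Longrightarrow> ract M (lact M h x) k = lact M h (ract M x k)"

text \<open>
  A bimodule map \<open>A \<otimes>\<^sub>H A \<rightarrow> A\<close> is the same as a biadditive, \<open>H\<close>-balanced operation
  on \<open>A\<close> that is left linear in the first and right linear in the second argument.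
\<close>

locale H_algebra = bimodule H A
  for H :: "'h ring" and A :: "('h, 'a) halg" +
  assumes mult_closed: "\<lbrakk>x \<in> carrier A; y \<in> carrier A\<rbrakk> \<Longrightarrow> x \<otimes>\<^bsub>A\<^esub> y \<in> carrier A"
    and mult_assoc: "\<lbrakk>x \<in> carrier A; y \<in> carrier A; z \<in> carrier A\<rbrakk>
      \<Longrightarrow> (x \<otimes>\<^bsub>A\<^esub> y) \<otimes>\<^bsub>A\<^esub> z = x \<otimes>\<^bsub>A\<^esub> (y \<otimes>\<^bsub>A\<^esub> z)"
    and mult_add_left: "\<lbrakk>x \<in> carrier A; y \<in> carrier A; z \<in> carrier A\<rbrakk>
      \<Longrightarrow> (x \<oplus>\<^bsub>A\<^esub> y) \<otimes>\<^bsub>A\<^esub> z = x \<otimes>\<^bsub>A\<^esub> z \<oplus>\<^bsub>A\<^esub> y \<otimes>\<^bsub>A\<^esub> z"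
    and mult_add_right: "\<lbrakk>x \<in> carrier A; y \<in> carrier A; z \<in> carrier A\<rbrakk>
      \<Longrightarrow> x \<otimes>\<^bsub>A\<^esub> (y \<oplus>\<^bsub>A\<^esub> z) = x \<otimes>\<^bsub>A\<^esub> y \<oplus>\<^bsub>A\<^esub> x \<otimes>\<^bsub>A\<^esub> z"
    and mult_balanced: "\<lbrakk>h \<in> carrier H; x \<in> carrier A; y \<in> carrier A\<rbrakk>
      \<Longrightarrow> ract A x h \<otimes>\<^bsub>A\<^esub> y = x \<otimes>\<^bsub>A\<^esub> lact A h y"
    and mult_lact: "\<lbrakk>h \<in> carrier H; x \<in> carrier A; y \<in> carrier A\<rbrakk>
      \<Longrightarrow> lact A h x \<otimes>\<^bsub>A\<^esub> y = lact A h (x \<otimes>\<^bsub>A\<^esub> y)"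
    and mult_ract: "\<lbrakk>h \<in> carrier H; x \<in> carrier A; y \<in> carrier A\<rbrakk>
      \<Longrightarrow> x \<otimes>\<^bsub>A\<^esub> ract A y h = ract A (x \<otimes>\<^bsub>A\<^esub> y) h"

definition central :: "'h ring \<Rightarrow> ('h, 'a) halg \<Rightarrow> bool" where
  "central H A \<longleftrightarrow> (\<forall>h \<in> carrier H. \<forall>x \<in> carrier A. lact A h x = ract A x h)"

definition H_alg_hom :: "'h ring \<Rightarrow> ('h, 'a) halg \<Rightarrow> ('h, 'b) halg \<Rightarrow> ('a \<Rightarrow> 'b) set" where
  "H_alg_hom H A B = {f \<in> carrier A \<rightarrow>\<^sub>E carrier B.
     (\<forall>x \<in> carrier A. \<forall>y \<in> carrier A. f (x \<oplus>\<^bsub>A\<^esub> y) = f x \<oplus>\<^bsub>B\<^esub> f y) \<and>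
     (\<forall>x \<in> carrier A. \<forall>y \<in> carrier A. f (x \<otimes>\<^bsub>A\<^esub> y) = f x \<otimes>\<^bsub>B\<^esub> f y) \<and>
     (\<forall>h \<in> carrier H. \<forall>x \<in> carrier A. f (lact A h x) = lact B h (f x)) \<and>
     (\<forall>h \<in> carrier H. \<forall>x \<in> carrier A. f (ract A x h) = ract B (f x) h)}"

text \<open>
  The algebras whose underlying set lies in the type \<open>'u\<close>, which plays the role of the
  universe of small sets; only the central ones if \<open>cen\<close> holds.
\<close>

definition Alg :: "'h ring \<Rightarrow> bool \<Rightarrow> (('h, 'u) halg, 'u \<Rightarrow> 'u) category" where
  "Alg H cen =
     \<lparr>obj = {A. H_algebra H A \<and> (cen \<longrightarrow> central H A)},
      homs = H_alg_hom H,
      ident = (\<lambda>A. \<lambda>x \<in> carrier A. x),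
      cmp = (\<lambda>X Y Z g f. compose (carrier X) g f)\<rparr>"

definition H_subalgebra :: "'h ring \<Rightarrow> 'a set \<Rightarrow> ('h, 'a) halg \<Rightarrow> bool" where
  "H_subalgebra H A B \<longleftrightarrow> subgroup A (add_monoid B) \<and>
     (\<forall>x \<in> A. \<forall>y \<in> A. x \<otimes>\<^bsub>B\<^esub> y \<in> A) \<and>
     (\<forall>h \<in> carrier H. \<forall>x \<in> A. lact B h x \<in> A \<and> ract B x h \<in> A)"


datatype 'a mat2 = Mat2 (e11: 'a) (e12: 'a) (e21: 'a) (e22: 'a)

definition M2 :: "('h, 'a) halg \<Rightarrow> ('h, 'a mat2) halg" where
  "M2 A =
     \<lparr>carrier = {m. set_mat2 m \<subseteq> carrier A},
      mult = (\<lambda>m n. Mat2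
        (e11 m \<otimes>\<^bsub>A\<^esub> e11 n \<oplus>\<^bsub>A\<^esub> e12 m \<otimes>\<^bsub>A\<^esub> e21 n) (e11 m \<otimes>\<^bsub>A\<^esub> e12 n \<oplus>\<^bsub>A\<^esub> e12 m \<otimes>\<^bsub>A\<^esub> e22 n)
        (e21 m \<otimes>\<^bsub>A\<^esub> e11 n \<oplus>\<^bsub>A\<^esub> e22 m \<otimes>\<^bsub>A\<^esub> e21 n) (e21 m \<otimes>\<^bsub>A\<^esub> e12 n \<oplus>\<^bsub>A\<^esub> e22 m \<otimes>\<^bsub>A\<^esub> e22 n)),
      one = Mat2 \<one>\<^bsub>A\<^esub> \<zero>\<^bsub>A\<^esub> \<zero>\<^bsub>A\<^esub> \<one>\<^bsub>A\<^esub>,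
      zero = Mat2 \<zero>\<^bsub>A\<^esub> \<zero>\<^bsub>A\<^esub> \<zero>\<^bsub>A\<^esub> \<zero>\<^bsub>A\<^esub>,
      add = (\<lambda>m n. Mat2 (e11 m \<oplus>\<^bsub>A\<^esub> e11 n) (e12 m \<oplus>\<^bsub>A\<^esub> e12 n) (e21 m \<oplus>\<^bsub>A\<^esub> e21 n) (e22 m \<oplus>\<^bsub>A\<^esub> e22 n)),
      lact = (\<lambda>h. map_mat2 (lact A h)),
      ract = (\<lambda>m h. map_mat2 (\<lambda>x. ract A x h) m)\<rparr>"

definition corner :: "('h, 'a) halg \<Rightarrow> 'a \<Rightarrow> 'a mat2" where
  "corner A = (\<lambda>a \<in> carrier A. Mat2 a \<zero>\<^bsub>A\<^esub> \<zero>\<^bsub>A\<^esub> \<zero>\<^bsub>A\<^esub>)"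

text \<open>
  The carrier of \<open>M2 A\<close> lies in \<open>'u mat2\<close> rather than \<open>'u\<close>. An object of \<open>Alg H cen\<close> that
  represents it is an algebra \<open>M\<close> with an isomorphism \<open>\<theta> : M2 A \<rightarrow> M\<close>; the condition is
  imposed for all such representatives (equivalently, as \<open>E\<close> preserves isomorphisms, for
  one of them). They exist for every \<open>A\<close> as soon as \<open>'u\<close> is infinite.
\<close>

definition M2_stable ::
  "'h ring \<Rightarrow> bool \<Rightarrow> ('p, 'n) category \<Rightarrow> (('h, 'u) halg \<Rightarrow> 'p) \<Rightarrow>
    (('h, 'u) halg \<Rightarrow> ('h, 'u) halg \<Rightarrow> ('u \<Rightarrow> 'u) \<Rightarrow> 'n) \<Rightarrow> bool" where
  "M2_stable H cen D Eo Em \<longleftrightarrow>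
     (\<forall>A \<in> obj (Alg H cen). \<forall>M \<in> obj (Alg H cen). \<forall>\<theta> \<in> H_alg_hom H (M2 A) M.
        bij_betw \<theta> (carrier (M2 A)) (carrier M) \<longrightarrow>
        is_iso D (Eo A) (Eo M) (Em A M (compose (carrier A) \<theta> (corner A))))"

definition phi :: "('h, 'a) halg \<Rightarrow> 'a set \<Rightarrow> 'a \<Rightarrow> 'a \<Rightarrow> 'a \<Rightarrow> 'a" where
  "phi B A V W = (\<lambda>a \<in> A. W \<otimes>\<^bsub>B\<^esub> a \<otimes>\<^bsub>B\<^esub> V)"

end

theory Submission
  imports Defs
begin

text \<open>
  Left multiplication by \<open>W\<close> and right multiplication by \<open>V\<close> restrict to maps \<open>l\<close> and \<open>r\<close> from
  \<open>A\<close> to itself, and \<open>\<phi> = l \<circ> r\<close>. In matrices over an algebra containing \<open>V\<close>, \<open>W\<close> and a unit one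
  would write
    \<open>\<Psi> m = diag(W, 1) m diag(V, 1)\<close>;
  the entries of the right-hand side are \<open>l (r a)\<close>, \<open>l b\<close>, \<open>r c\<close>, \<open>d\<close>, so that \<open>\<Psi>\<close> makes sense
  as an endomorphism of \<open>M2 A\<close>, and it is multiplicative because \<open>r x \<otimes> l y = x \<otimes> y\<close>.

  Let \<open>i\<close> and \<open>j\<close> be the upper left and the lower right corner inclusions \<open>A \<rightarrow> M2 A\<close>. Then
  \<open>\<Psi> \<circ> i = i \<circ> \<phi>\<close> and \<open>\<Psi> \<circ> j = j\<close>. Stability says that \<open>E i\<close> is invertible, and so is \<open>E j\<close>,
  because \<open>j\<close> is \<open>i\<close> followed by the automorphism that conjugates with the permutation matrix.
  The second identity therefore gives \<open>E \<Psi> = 1\<close>, and then the first one gives \<open>E i = E i \<circ> E \<phi>\<close>,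
  hence \<open>E \<phi> = 1\<close>.

  The functor sees \<open>M2 A\<close> only through algebras carried by the same type as \<open>A\<close>. One such copy
  \<open>\<theta> : M2 A \<rightarrow> M\<close> exists because that type is infinite, and the argument runs in \<open>M\<close>. Since
  stability holds for every isomorphism onto \<open>M\<close>, it applies both to \<open>\<theta>\<close> and to \<open>\<theta>\<close> preceded by
  the permutation automorphism; these provide \<open>i\<close> and \<open>j\<close>.
\<close>

section \<open>A criterion for a functor to map an endomorphism to the identity\<close>

lemma (in category) iso_cancel_right:
  assumes "X \<in> obj C" "Y \<in> obj C" "is_iso C X Y f" "e \<in> homs C Y Y"
    and "cmp C X Y Y e f = f"
  shows "e = ident C Y"
proof -
  obtain g where f: "f \<in> homs C X Y" and g: "g \<in> homs C Y X"
    and fg: "cmp C Y X Y f g = ident C Y"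
    using assms(3) unfolding is_iso_def by blast
  have "e = cmp C Y Y Y e (cmp C Y X Y f g)"
    using assms fg by (simp add: cmp_ident_right)
  also have "\<dots> = cmp C Y X Y (cmp C X Y Y e f) g"
    using assms f g by (simp add: cmp_assoc)
  finally show ?thesis
    using assms(5) fg by simp
qed

lemma (in category) iso_cancel_left:
  assumes "X \<in> obj C" "Y \<in> obj C" "is_iso C X Y f" "e \<in> homs C X X"
    and "cmp C X X Y f e = f"
  shows "e = ident C X"
proof -
  obtain g where f: "f \<in> homs C X Y" and g: "g \<in> homs C Y X"
    and gf: "cmp C X Y X g f = ident C X"
    using assms(3) unfolding is_iso_def by blast
  have "e = cmp C X X X (cmp C X Y X g f) e"
    using assms gf by (simp add: cmp_ident_left)
  also have "\<dots> = cmp C X Y X g (cmp C X X Y f e)"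
    using cmp_assoc[of X X Y X e f g] assms(1,2,4) f g by simp
  finally show ?thesis
    using assms(5) gf by simp
qed

text \<open>
  The arrow \<open>j\<close> forces \<open>\<psi>\<close> to become an identity, and \<open>i\<close> then passes this on to \<open>\<phi>\<close>.
\<close>

lemma (in covariant_functor) map_eq_ident_via_two_isos:
  assumes "category D"
    and X: "X \<in> obj C" and Y: "Y \<in> obj C"
    and i: "i \<in> homs C X Y" and j: "j \<in> homs C X Y"
    and iso_i: "is_iso D (Fo X) (Fo Y) (Fm X Y i)" and iso_j: "is_iso D (Fo X) (Fo Y) (Fm X Y j)"
    and \<phi>: "\<phi> \<in> homs C X X" and \<psi>: "\<psi> \<in> homs C Y Y"
    and \<psi>_i: "cmp C X Y Y \<psi> i = cmp C X X Y i \<phi>" and \<psi>_j: "cmp C X Y Y \<psi> j = j"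
  shows "Fm X X \<phi> = ident D (Fo X)"
proof -
  interpret D: category D by fact
  have "cmp D (Fo X) (Fo Y) (Fo Y) (Fm Y Y \<psi>) (Fm X Y j) = Fm X Y j"
    using map_cmp[OF X Y Y j \<psi>] \<psi>_j by simp
  then have "Fm Y Y \<psi> = ident D (Fo Y)"
    using D.iso_cancel_right X Y iso_j obj_in arr_in \<psi> by blast
  then have "cmp D (Fo X) (Fo X) (Fo Y) (Fm X Y i) (Fm X X \<phi>) = Fm X Y i"
    using map_cmp[OF X Y Y i \<psi>] map_cmp[OF X X Y \<phi> i] \<psi>_i X Y i
    by (simp add: D.cmp_ident_left obj_in arr_in)
  then show ?thesis
    using D.iso_cancel_left X Y iso_i obj_in arr_in \<phi> by blast
qed

section \<open>Algebras, subalgebras and homomorphisms\<close>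

context H_algebra
begin

lemma mult_zero_left: "x \<in> carrier A \<Longrightarrow> \<zero>\<^bsub>A\<^esub> \<otimes>\<^bsub>A\<^esub> x = \<zero>\<^bsub>A\<^esub>"
  using mult_add_left[of "\<zero>\<^bsub>A\<^esub>" "\<zero>\<^bsub>A\<^esub>" x] by (simp add: mult_closed)

lemma mult_zero_right: "x \<in> carrier A \<Longrightarrow> x \<otimes>\<^bsub>A\<^esub> \<zero>\<^bsub>A\<^esub> = \<zero>\<^bsub>A\<^esub>"
  using mult_add_right[of x "\<zero>\<^bsub>A\<^esub>" "\<zero>\<^bsub>A\<^esub>"] by (simp add: mult_closed)

lemma lact_zero: "h \<in> carrier H \<Longrightarrow> lact A h \<zero>\<^bsub>A\<^esub> = \<zero>\<^bsub>A\<^esub>"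
  using lact_add_right[of h "\<zero>\<^bsub>A\<^esub>" "\<zero>\<^bsub>A\<^esub>"] by (simp add: lact_closed)

lemma ract_zero: "h \<in> carrier H \<Longrightarrow> ract A \<zero>\<^bsub>A\<^esub> h = \<zero>\<^bsub>A\<^esub>"
  using ract_add_left[of h "\<zero>\<^bsub>A\<^esub>" "\<zero>\<^bsub>A\<^esub>"] by (simp add: ract_closed)

lemmas operation_closed =
  mult_closed lact_closed ract_closed

lemmas zero_laws =
  mult_zero_left mult_zero_right lact_zero ract_zero

end

lemma H_algebra_subalgebra:
  assumes "H_algebra H B" "H_subalgebra H A B"
  shows "H_algebra H (B\<lparr>carrier := A\<rparr>)"
proof -
  interpret B: H_algebra H B by fact
  have sub: "subgroup A (add_monoid B)"
    and closed: "\<And>x y. x \<in> A \<Longrightarrow> y \<in> A \<Longrightarrow> x \<otimes>\<^bsub>B\<^esub> y \<in> A"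
      "\<And>h x. h \<in> carrier H \<Longrightarrow> x \<in> A \<Longrightarrow> lact B h x \<in> A"
      "\<And>h x. h \<in> carrier H \<Longrightarrow> x \<in> A \<Longrightarrow> ract B x h \<in> A"
    using assms(2) unfolding H_subalgebra_def by blast+
  have AB: "x \<in> carrier B" if "x \<in> A" for x
    using subgroup.subset[OF sub] that by auto
  have "abelian_group (B\<lparr>carrier := A\<rparr>)"
  proof (rule abelian_groupI)
    fix x assume "x \<in> carrier (B\<lparr>carrier := A\<rparr>)"
    then show "\<exists>y\<in>carrier (B\<lparr>carrier := A\<rparr>).
        y \<oplus>\<^bsub>B\<lparr>carrier := A\<rparr>\<^esub> x = \<zero>\<^bsub>B\<lparr>carrier := A\<rparr>\<^esub>"
      using subgroup.m_inv_closed[OF sub] AB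
      by (intro bexI[of _ "\<ominus>\<^bsub>B\<^esub> x"]) (simp_all add: a_inv_def[symmetric] B.M.l_neg)
  qed (use subgroup.m_closed[OF sub] subgroup.one_closed[OF sub] AB
       in \<open>simp_all add: B.M.a_assoc B.M.a_comm B.M.a_lcomm\<close>)
  then show ?thesis
    unfolding H_algebra_def bimodule_def bimodule_axioms_def H_algebra_axioms_def
    using B.H.ring_axioms closed AB
    by (simp add: B.lact_add_left B.lact_add_right B.lact_mult B.lact_one
        B.ract_add_left B.ract_add_right B.ract_mult B.ract_one B.lact_ract
        B.mult_assoc B.mult_add_left B.mult_add_right B.mult_balanced B.mult_lact B.mult_ract)
qed

lemma H_alg_homI:
  assumes "f \<in> extensional (carrier A)"
    and "\<And>x. x \<in> carrier A \<Longrightarrow> f x \<in> carrier B"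
    and "\<And>x y. x \<in> carrier A \<Longrightarrow> y \<in> carrier A \<Longrightarrow> f (x \<oplus>\<^bsub>A\<^esub> y) = f x \<oplus>\<^bsub>B\<^esub> f y"
    and "\<And>x y. x \<in> carrier A \<Longrightarrow> y \<in> carrier A \<Longrightarrow> f (x \<otimes>\<^bsub>A\<^esub> y) = f x \<otimes>\<^bsub>B\<^esub> f y"
    and "\<And>h x. h \<in> carrier H \<Longrightarrow> x \<in> carrier A \<Longrightarrow> f (lact A h x) = lact B h (f x)"
    and "\<And>h x. h \<in> carrier H \<Longrightarrow> x \<in> carrier A \<Longrightarrow> f (ract A x h) = ract B (f x) h"
  shows "f \<in> H_alg_hom H A B"
  using assms by (auto simp: H_alg_hom_def PiE_def)

lemma H_alg_hom_closed: "f \<in> H_alg_hom H A B \<Longrightarrow> x \<in> carrier A \<Longrightarrow> f x \<in> carrier B"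
  by (auto simp: H_alg_hom_def)

lemma (in H_algebra) H_alg_hom_compose:
  assumes "f \<in> H_alg_hom H A B" "g \<in> H_alg_hom H B C"
  shows "compose (carrier A) g f \<in> H_alg_hom H A C"
  using assms H_alg_hom_closed[OF assms(1)] H_alg_hom_closed[OF assms(2)]
  by (intro H_alg_homI) (simp_all add: compose_eq operation_closed H_alg_hom_def)

lemma (in H_algebra) H_alg_hom_inverse:
  assumes f: "f \<in> H_alg_hom H A B" and bij: "bij_betw f (carrier A) (carrier B)"
  shows "restrict (the_inv_into (carrier A) f) (carrier B) \<in> H_alg_hom H B A"
proof -
  define g where "g = restrict (the_inv_into (carrier A) f) (carrier B)"
  have inj: "inj_on f (carrier A)" and im: "carrier B = f ` carrier A"
    using bij by (auto simp: bij_betw_def)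
  have g_f: "g (f x) = x" if "x \<in> carrier A" for x
    using that inj im by (simp add: g_def the_inv_into_f_f)
  have op: "f x \<oplus>\<^bsub>B\<^esub> f y = f (x \<oplus>\<^bsub>A\<^esub> y)" "f x \<otimes>\<^bsub>B\<^esub> f y = f (x \<otimes>\<^bsub>A\<^esub> y)"
    if "x \<in> carrier A" "y \<in> carrier A" for x y
    using f that by (auto simp: H_alg_hom_def)
  have act: "lact B h (f x) = f (lact A h x)" "ract B (f x) h = f (ract A x h)"
    if "h \<in> carrier H" "x \<in> carrier A" for h x
    using f that by (auto simp: H_alg_hom_def)
  have "g \<in> extensional (carrier B)"
    by (simp add: g_def)
  then have "g \<in> H_alg_hom H B A"
    by (rule H_alg_homI) (auto simp: im op act g_f operation_closed)
  then show ?thesis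
    by (simp add: g_def)
qed

section \<open>Two by two matrices\<close>

lemma M2_simps:
  "Mat2 a b c d \<in> carrier (M2 A) \<longleftrightarrow>
     a \<in> carrier A \<and> b \<in> carrier A \<and> c \<in> carrier A \<and> d \<in> carrier A"
  "\<zero>\<^bsub>M2 A\<^esub> = Mat2 \<zero>\<^bsub>A\<^esub> \<zero>\<^bsub>A\<^esub> \<zero>\<^bsub>A\<^esub> \<zero>\<^bsub>A\<^esub>"
  "Mat2 a b c d \<oplus>\<^bsub>M2 A\<^esub> Mat2 a' b' c' d' =
     Mat2 (a \<oplus>\<^bsub>A\<^esub> a') (b \<oplus>\<^bsub>A\<^esub> b') (c \<oplus>\<^bsub>A\<^esub> c') (d \<oplus>\<^bsub>A\<^esub> d')"
  "Mat2 a b c d \<otimes>\<^bsub>M2 A\<^esub> Mat2 a' b' c' d' =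
     Mat2 (a \<otimes>\<^bsub>A\<^esub> a' \<oplus>\<^bsub>A\<^esub> b \<otimes>\<^bsub>A\<^esub> c') (a \<otimes>\<^bsub>A\<^esub> b' \<oplus>\<^bsub>A\<^esub> b \<otimes>\<^bsub>A\<^esub> d')
       (c \<otimes>\<^bsub>A\<^esub> a' \<oplus>\<^bsub>A\<^esub> d \<otimes>\<^bsub>A\<^esub> c') (c \<otimes>\<^bsub>A\<^esub> b' \<oplus>\<^bsub>A\<^esub> d \<otimes>\<^bsub>A\<^esub> d')"
  "lact (M2 A) h (Mat2 a b c d) = Mat2 (lact A h a) (lact A h b) (lact A h c) (lact A h d)"
  "ract (M2 A) (Mat2 a b c d) h = Mat2 (ract A a h) (ract A b h) (ract A c h) (ract A d h)"
  by (auto simp: M2_def)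

lemma M2_cases:
  assumes "m \<in> carrier (M2 A)"
  obtains a b c d where "m = Mat2 a b c d"
    "a \<in> carrier A" "b \<in> carrier A" "c \<in> carrier A" "d \<in> carrier A"
  using assms by (cases m) (auto simp: M2_simps)

lemma (in H_algebra) H_algebra_M2: "H_algebra H (M2 A)"
proof -
  note ac = M.a_assoc M.a_comm M.a_lcomm
  have "abelian_group (M2 A)"
  proof (rule abelian_groupI)
    fix x assume "x \<in> carrier (M2 A)"
    then obtain a b c d where x: "x = Mat2 a b c d"
      "a \<in> carrier A" "b \<in> carrier A" "c \<in> carrier A" "d \<in> carrier A"
      by (rule M2_cases)
    then show "\<exists>y\<in>carrier (M2 A). y \<oplus>\<^bsub>M2 A\<^esub> x = \<zero>\<^bsub>M2 A\<^esub>"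
      by (intro bexI[of _ "Mat2 (\<ominus>\<^bsub>A\<^esub> a) (\<ominus>\<^bsub>A\<^esub> b) (\<ominus>\<^bsub>A\<^esub> c) (\<ominus>\<^bsub>A\<^esub> d)"])
        (simp_all add: M2_simps M.l_neg)
  qed (auto elim!: M2_cases simp: M2_simps ac)
  moreover have "bimodule_axioms H (M2 A)"
    by (rule bimodule_axioms.intro)
      (auto elim!: M2_cases simp: M2_simps operation_closed lact_add_left lact_add_right
        lact_mult lact_one ract_add_left ract_add_right ract_mult ract_one lact_ract)
  moreover have "H_algebra_axioms H (M2 A)"
    by (rule H_algebra_axioms.intro)
      (auto elim!: M2_cases simp: M2_simps operation_closed mult_assoc mult_add_left
        mult_add_right mult_balanced mult_lact mult_ract lact_add_right ract_add_left ac)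
  ultimately show ?thesis
    using H.ring_axioms by (simp add: H_algebra_def bimodule_def)
qed

lemma central_M2: "central H A \<Longrightarrow> central H (M2 A)"
  by (auto simp: central_def M2_simps elim!: M2_cases)

lemma (in H_algebra) corner_hom: "corner A \<in> H_alg_hom H A (M2 A)"
  by (rule H_alg_homI)
    (simp_all add: corner_def M2_simps operation_closed zero_laws)

text \<open>
  Conjugation by the matrix that exchanges the two coordinates; it takes one diagonal corner to
  the other.
\<close>

definition mat2_flip :: "('h, 'a) halg \<Rightarrow> 'a mat2 \<Rightarrow> 'a mat2" where
  "mat2_flip A = (\<lambda>m \<in> carrier (M2 A). Mat2 (e22 m) (e21 m) (e12 m) (e11 m))"

lemma (in H_algebra) mat2_flip_hom: "mat2_flip A \<in> H_alg_hom H (M2 A) (M2 A)"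
  by (rule H_alg_homI)
    (auto elim!: M2_cases simp: mat2_flip_def M2_simps operation_closed M.a_comm)

lemma bij_betw_mat2_flip: "bij_betw (mat2_flip A) (carrier (M2 A)) (carrier (M2 A))"
  by (rule bij_betw_byWitness[where f' = "mat2_flip A"])
    (auto elim!: M2_cases simp: mat2_flip_def M2_simps)

section \<open>A copy of the matrix algebra in the type of its entries\<close>

definition transported :: "('a \<Rightarrow> 'b) \<Rightarrow> ('h, 'a) halg \<Rightarrow> ('h, 'b) halg" where
  "transported f A = (let g = the_inv_into (carrier A) f in
     \<lparr>carrier = f ` carrier A,
      mult = (\<lambda>x y. f (g x \<otimes>\<^bsub>A\<^esub> g y)),
      one = f \<one>\<^bsub>A\<^esub>,
      zero = f \<zero>\<^bsub>A\<^esub>,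
      add = (\<lambda>x y. f (g x \<oplus>\<^bsub>A\<^esub> g y)),
      lact = (\<lambda>h x. f (lact A h (g x))),
      ract = (\<lambda>x h. f (ract A (g x) h))\<rparr>)"

lemma transported_simps:
  assumes "inj_on f (carrier A)"
  shows "carrier (transported f A) = f ` carrier A"
    and "\<zero>\<^bsub>transported f A\<^esub> = f \<zero>\<^bsub>A\<^esub>"
    and "x \<in> carrier A \<Longrightarrow> y \<in> carrier A \<Longrightarrow> f x \<oplus>\<^bsub>transported f A\<^esub> f y = f (x \<oplus>\<^bsub>A\<^esub> y)"
    and "x \<in> carrier A \<Longrightarrow> y \<in> carrier A \<Longrightarrow> f x \<otimes>\<^bsub>transported f A\<^esub> f y = f (x \<otimes>\<^bsub>A\<^esub> y)"
    and "x \<in> carrier A \<Longrightarrow> lact (transported f A) h (f x) = f (lact A h x)"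
    and "x \<in> carrier A \<Longrightarrow> ract (transported f A) (f x) h = f (ract A x h)"
  using assms by (simp_all add: transported_def Let_def the_inv_into_f_f)

lemma (in H_algebra) H_algebra_transported:
  assumes "inj_on f (carrier A)"
  shows "H_algebra H (transported f A)"
proof -
  note t = transported_simps[OF assms]
  have "abelian_group (transported f A)"
  proof (rule abelian_groupI)
    fix x assume "x \<in> carrier (transported f A)"
    then obtain a where "x = f a" "a \<in> carrier A"
      by (auto simp: t)
    then show "\<exists>y\<in>carrier (transported f A). y \<oplus>\<^bsub>transported f A\<^esub> x = \<zero>\<^bsub>transported f A\<^esub>"
      by (intro bexI[of _ "f (\<ominus>\<^bsub>A\<^esub> a)"]) (simp_all add: t M.l_neg)
  qed (auto simp: t M.a_assoc M.a_comm M.a_lcomm)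
  moreover have "bimodule_axioms H (transported f A)"
    by (rule bimodule_axioms.intro)
      (auto simp: t operation_closed lact_add_left lact_add_right
        lact_mult lact_one ract_add_left ract_add_right ract_mult ract_one lact_ract)
  moreover have "H_algebra_axioms H (transported f A)"
    by (rule H_algebra_axioms.intro)
      (auto simp: t operation_closed mult_assoc mult_add_left
        mult_add_right mult_balanced mult_lact mult_ract)
  ultimately show ?thesis
    using H.ring_axioms by (simp add: H_algebra_def bimodule_def)
qed

lemma central_transported:
  "inj_on f (carrier A) \<Longrightarrow> central H A \<Longrightarrow> central H (transported f A)"
  by (auto simp: central_def transported_simps)

lemma (in H_algebra) transported_hom:
  assumes "inj_on f (carrier A)"
  shows "restrict f (carrier A) \<in> H_alg_hom H A (transported f A)"
  by (rule H_alg_homI)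
    (simp_all add: transported_simps[OF assms] operation_closed)

text \<open>A pairing function on the infinite type, used twice.\<close>

lemma ex_inj_mat2:
  assumes "infinite (UNIV :: 'u set)"
  shows "\<exists>f :: 'u mat2 \<Rightarrow> 'u. inj f"
proof -
  obtain p :: "'u \<times> 'u \<Rightarrow> 'u" where "bij_betw p (UNIV \<times> UNIV) UNIV"
    using card_of_Times_same_infinite[OF assms] unfolding card_of_ordIso[symmetric] by blast
  then have "inj p"
    by (simp add: bij_betw_def)
  then have "inj (\<lambda>m. p (p (e11 m, e12 m), p (e21 m, e22 m)))"
    by (intro injI mat2.expand) (simp add: inj_eq)
  then show ?thesis
    by blast
qed

lemma ex_M2_representative:
  fixes A :: "('h, 'u) halg"
  assumes "infinite (UNIV :: 'u set)" and "H_algebra H A"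
  obtains M :: "('h, 'u) halg" and \<theta> where
    "\<theta> \<in> H_alg_hom H (M2 A) M" "bij_betw \<theta> (carrier (M2 A)) (carrier M)"
    "H_algebra H M" "central H A \<Longrightarrow> central H M"
proof -
  obtain f :: "'u mat2 \<Rightarrow> 'u" where "inj f"
    using ex_inj_mat2[OF assms(1)] by blast
  then have inj: "inj_on f (carrier (M2 A))"
    by (rule inj_on_subset) simp
  interpret M2: H_algebra H "M2 A"
    using assms(2) by (rule H_algebra.H_algebra_M2)
  show ?thesis
  proof (rule that)
    show "restrict f (carrier (M2 A)) \<in> H_alg_hom H (M2 A) (transported f (M2 A))"
      using inj by (rule M2.transported_hom)
    show "bij_betw (restrict f (carrier (M2 A))) (carrier (M2 A))
        (carrier (transported f (M2 A)))"
      using inj by (simp add: bij_betw_def transported_simps)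
    show "H_algebra H (transported f (M2 A))"
      using inj by (rule M2.H_algebra_transported)
    show "central H (transported f (M2 A))" if "central H A"
      using inj central_M2[OF that] by (rule central_transported)
  qed
qed

section \<open>Conjugation by a pair of multipliers\<close>

text \<open>
  The operators \<open>l = (\<lambda>a. W a)\<close> and \<open>r = (\<lambda>a. a V)\<close> abstract from the ambient algebra in which \<open>V\<close>
  and \<open>W\<close> live: only the induced operators on \<open>A\<close> enter the construction. Associativity of the
  ambient product becomes \<open>l_mult\<close>, \<open>r_mult\<close> and \<open>l_r\<close>, the relation \<open>a V W a' = a a'\<close> becomes
  \<open>r_mult_l\<close>, and \<open>l_lact\<close> and \<open>r_ract\<close> hold because \<open>W\<close> and \<open>V\<close> commute with \<open>H\<close>.
\<close>

locale multiplier_pair = H_algebra H A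
  for H :: "'h ring" and A :: "('h, 'a) halg" +
  fixes l r :: "'a \<Rightarrow> 'a"
  assumes l_closed: "x \<in> carrier A \<Longrightarrow> l x \<in> carrier A"
    and r_closed: "x \<in> carrier A \<Longrightarrow> r x \<in> carrier A"
    and l_add: "\<lbrakk>x \<in> carrier A; y \<in> carrier A\<rbrakk> \<Longrightarrow> l (x \<oplus>\<^bsub>A\<^esub> y) = l x \<oplus>\<^bsub>A\<^esub> l y"
    and r_add: "\<lbrakk>x \<in> carrier A; y \<in> carrier A\<rbrakk> \<Longrightarrow> r (x \<oplus>\<^bsub>A\<^esub> y) = r x \<oplus>\<^bsub>A\<^esub> r y"
    and l_mult: "\<lbrakk>x \<in> carrier A; y \<in> carrier A\<rbrakk> \<Longrightarrow> l (x \<otimes>\<^bsub>A\<^esub> y) = l x \<otimes>\<^bsub>A\<^esub> y"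
    and r_mult: "\<lbrakk>x \<in> carrier A; y \<in> carrier A\<rbrakk> \<Longrightarrow> r (x \<otimes>\<^bsub>A\<^esub> y) = x \<otimes>\<^bsub>A\<^esub> r y"
    and l_r: "x \<in> carrier A \<Longrightarrow> l (r x) = r (l x)"
    and r_mult_l: "\<lbrakk>x \<in> carrier A; y \<in> carrier A\<rbrakk> \<Longrightarrow> r x \<otimes>\<^bsub>A\<^esub> l y = x \<otimes>\<^bsub>A\<^esub> y"
    and l_lact: "\<lbrakk>h \<in> carrier H; x \<in> carrier A\<rbrakk> \<Longrightarrow> l (lact A h x) = lact A h (l x)"
    and l_ract: "\<lbrakk>h \<in> carrier H; x \<in> carrier A\<rbrakk> \<Longrightarrow> l (ract A x h) = ract A (l x) h"
    and r_lact: "\<lbrakk>h \<in> carrier H; x \<in> carrier A\<rbrakk> \<Longrightarrow> r (lact A h x) = lact A h (r x)"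
    and r_ract: "\<lbrakk>h \<in> carrier H; x \<in> carrier A\<rbrakk> \<Longrightarrow> r (ract A x h) = ract A (r x) h"
begin

definition sandwich :: "'a \<Rightarrow> 'a" where
  "sandwich = (\<lambda>a \<in> carrier A. l (r a))"

text \<open>
  The product \<open>diag(W, 1) m diag(V, 1)\<close>; the entry \<open>1\<close> makes it fix the lower right corner.
\<close>

definition mat2_sandwich :: "'a mat2 \<Rightarrow> 'a mat2" where
  "mat2_sandwich = (\<lambda>m \<in> carrier (M2 A). Mat2 (l (r (e11 m))) (l (e12 m)) (r (e21 m)) (e22 m))"

lemmas multiplier_laws =
  l_closed r_closed l_add r_add l_lact l_ract r_lact r_ract

lemma l_zero: "l \<zero>\<^bsub>A\<^esub> = \<zero>\<^bsub>A\<^esub>"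
  using l_add[of "\<zero>\<^bsub>A\<^esub>" "\<zero>\<^bsub>A\<^esub>"] by (simp add: l_closed)

lemma r_zero: "r \<zero>\<^bsub>A\<^esub> = \<zero>\<^bsub>A\<^esub>"
  using r_add[of "\<zero>\<^bsub>A\<^esub>" "\<zero>\<^bsub>A\<^esub>"] by (simp add: r_closed)

text \<open>
  As rewrite rules these move \<open>l\<close> and \<open>r\<close> out of a product, \<open>l\<close> to the front, and cancel them
  where they meet inside. This is the computation \<open>W a V W a' V = W a a' V\<close>, and likewise for
  each of the eight products of entries in a product of two matrices.
\<close>

lemmas multiplier_mult =
  l_mult[symmetric] r_mult[symmetric] l_r[symmetric] r_mult_l

lemma sandwich_hom: "sandwich \<in> H_alg_hom H A A"
  by (rule H_alg_homI)
    (simp_all add: sandwich_def multiplier_laws operation_closed multiplier_mult)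

lemma mat2_sandwich_hom: "mat2_sandwich \<in> H_alg_hom H (M2 A) (M2 A)"
  by (rule H_alg_homI)
    (auto elim!: M2_cases simp: mat2_sandwich_def M2_simps multiplier_laws operation_closed
      multiplier_mult)

lemma mat2_sandwich_corner:
  "a \<in> carrier A \<Longrightarrow> mat2_sandwich (corner A a) = corner A (sandwich a)"
  by (simp add: mat2_sandwich_def corner_def sandwich_def M2_simps multiplier_laws l_zero r_zero)

lemma mat2_sandwich_flip_corner:
  "a \<in> carrier A \<Longrightarrow> mat2_sandwich (mat2_flip A (corner A a)) = mat2_flip A (corner A a)"
  by (simp add: mat2_sandwich_def corner_def mat2_flip_def M2_simps multiplier_laws l_zero r_zero)

end

section \<open>Stable functors do not see the sandwich map\<close>

text \<open>
  The identities \<open>mat2_sandwich_corner\<close> and \<open>mat2_sandwich_flip_corner\<close>, carried along \<open>\<theta>\<close>, are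
  the two relations required by \<open>map_eq_ident_via_two_isos\<close>.
\<close>

lemma (in multiplier_pair) M2_stable_sandwich:
  fixes Eo :: "('h, 'a) halg \<Rightarrow> 'p"
    and Em :: "('h, 'a) halg \<Rightarrow> ('h, 'a) halg \<Rightarrow> ('a \<Rightarrow> 'a) \<Rightarrow> 'n"
  assumes inf: "infinite (UNIV :: 'a set)"
    and cen: "cen \<Longrightarrow> central H A"
    and D: "category D"
    and E: "covariant_functor (Alg H cen) D Eo Em"
    and stable: "M2_stable H cen D Eo Em"
  shows "Em A A sandwich = ident D (Eo A)"
proof -
  interpret M2: H_algebra H "M2 A"
    by (rule H_algebra_M2)
  obtain M :: "('h, 'a) halg" and \<theta> where \<theta>: "\<theta> \<in> H_alg_hom H (M2 A) M"
    and bij: "bij_betw \<theta> (carrier (M2 A)) (carrier M)"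
    and M: "H_algebra H M" "central H A \<Longrightarrow> central H M"
    using ex_M2_representative[OF inf H_algebra_axioms] by blast
  interpret M: H_algebra H M
    by (rule M(1))
  define \<eta> where "\<eta> = restrict (the_inv_into (carrier (M2 A)) \<theta>) (carrier M)"
  have \<eta>: "\<eta> \<in> H_alg_hom H M (M2 A)"
    unfolding \<eta>_def using \<theta> bij by (rule M2.H_alg_hom_inverse)
  have \<eta>_\<theta>: "\<eta> (\<theta> m) = m" if "m \<in> carrier (M2 A)" for m
    using bij that H_alg_hom_closed[OF \<theta> that]
    by (simp add: \<eta>_def bij_betw_def the_inv_into_f_f)
  have A_obj: "A \<in> obj (Alg H cen)" and M_obj: "M \<in> obj (Alg H cen)"
    using H_algebra_axioms M cen by (auto simp: Alg_def)
  \<comment> \<open>A second isomorphism onto \<open>M\<close>; its restriction to the upper left corner is the restriction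
    of \<open>\<theta>\<close> to the lower right one.\<close>
  define \<theta>' where "\<theta>' = compose (carrier (M2 A)) \<theta> (mat2_flip A)"
  have \<theta>': "\<theta>' \<in> H_alg_hom H (M2 A) M"
    unfolding \<theta>'_def using mat2_flip_hom \<theta> by (rule M2.H_alg_hom_compose)
  have bij': "bij_betw \<theta>' (carrier (M2 A)) (carrier M)"
    unfolding \<theta>'_def using bij_betw_mat2_flip bij by (rule bij_betw_compose)
  define i where "i = compose (carrier A) \<theta> (corner A)"
  define j where "j = compose (carrier A) \<theta>' (corner A)"
  have i_hom: "i \<in> H_alg_hom H A M" and j_hom: "j \<in> H_alg_hom H A M"
    unfolding i_def j_def using corner_hom \<theta> \<theta>' by (auto intro: H_alg_hom_compose)
  have isos: "is_iso D (Eo A) (Eo M) (Em A M i)" "is_iso D (Eo A) (Eo M) (Em A M j)"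
    using stable A_obj M_obj \<theta> bij \<theta>' bij' unfolding M2_stable_def i_def j_def by blast+
  \<comment> \<open>\<open>\<eta>\<close> is inverse to \<open>\<theta>\<close>, so this is \<open>mat2_sandwich\<close> acting on the copy \<open>M\<close>.\<close>
  define \<psi> where
    "\<psi> = compose (carrier M) \<theta> (compose (carrier M) mat2_sandwich \<eta>)"
  have \<psi>_hom: "\<psi> \<in> H_alg_hom H M M"
    unfolding \<psi>_def using \<eta> mat2_sandwich_hom \<theta> by (intro M.H_alg_hom_compose)
  have \<psi>_\<theta>: "\<psi> (\<theta> m) = \<theta> (mat2_sandwich m)" if "m \<in> carrier (M2 A)" for m
    using that H_alg_hom_closed[OF \<theta> that] \<eta>_\<theta> by (simp add: \<psi>_def compose_eq)
  have corner: "corner A a \<in> carrier (M2 A)" if "a \<in> carrier A" for a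
    using corner_hom that by (rule H_alg_hom_closed)
  have flip: "mat2_flip A m \<in> carrier (M2 A)" if "m \<in> carrier (M2 A)" for m
    using mat2_flip_hom that by (rule H_alg_hom_closed)
  have sandwich: "sandwich a \<in> carrier A" if "a \<in> carrier A" for a
    using sandwich_hom that by (rule H_alg_hom_closed)
  have \<psi>_i: "compose (carrier A) \<psi> i = compose (carrier A) i sandwich"
    by (rule extensionalityI[of _ "carrier A"])
      (simp_all add: compose_eq i_def corner sandwich \<psi>_\<theta> mat2_sandwich_corner)
  have \<psi>_j: "compose (carrier A) \<psi> j = j"
    by (rule extensionalityI[of _ "carrier A"])
      (simp_all add: compose_eq j_def \<theta>'_def corner flip \<psi>_\<theta> mat2_sandwich_flip_corner)
  show ?thesis
    by (rule covariant_functor.map_eq_ident_via_two_isos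
        [OF E D A_obj M_obj, where i = i and j = j and \<psi> = \<psi>])
      (simp_all add: Alg_def i_hom j_hom isos sandwich_hom \<psi>_hom \<psi>_i \<psi>_j)
qed

text \<open>
  Since \<open>V\<close> and \<open>W\<close> are elements of \<open>B\<close> only, \<open>V\<close> may move \<open>A\<close> out of itself when it multiplies
  from the left, and \<open>W\<close> when it multiplies from the right; the operators below use the two
  sides on which \<open>A\<close> is preserved.
\<close>

lemma multiplier_pair_of_elements:
  assumes "H_algebra H B" "H_subalgebra H A B"
    and V: "V \<in> carrier B" and W: "W \<in> carrier B"
    and WA: "\<And>a. a \<in> A \<Longrightarrow> W \<otimes>\<^bsub>B\<^esub> a \<in> A"
    and AV: "\<And>a. a \<in> A \<Longrightarrow> a \<otimes>\<^bsub>B\<^esub> V \<in> A"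
    and AVWA: "\<And>a a'. \<lbrakk>a \<in> A; a' \<in> A\<rbrakk> \<Longrightarrow>
      a \<otimes>\<^bsub>B\<^esub> V \<otimes>\<^bsub>B\<^esub> W \<otimes>\<^bsub>B\<^esub> a' = a \<otimes>\<^bsub>B\<^esub> a'"
    and hV: "\<And>h. h \<in> carrier H \<Longrightarrow> lact B h V = ract B V h"
    and hW: "\<And>h. h \<in> carrier H \<Longrightarrow> lact B h W = ract B W h"
  shows "multiplier_pair H (B\<lparr>carrier := A\<rparr>) (\<lambda>a. W \<otimes>\<^bsub>B\<^esub> a) (\<lambda>a. a \<otimes>\<^bsub>B\<^esub> V)"
proof -
  interpret B: H_algebra H B by fact
  have AB: "x \<in> carrier B" if "x \<in> A" for x
    using assms(2) that subgroup.subset unfolding H_subalgebra_def by force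
  show ?thesis
  proof (intro multiplier_pair.intro multiplier_pair_axioms.intro)
    show "H_algebra H (B\<lparr>carrier := A\<rparr>)"
      using assms(1,2) by (rule H_algebra_subalgebra)
    fix x y assume "x \<in> carrier (B\<lparr>carrier := A\<rparr>)" "y \<in> carrier (B\<lparr>carrier := A\<rparr>)"
    then show "x \<otimes>\<^bsub>B\<^esub> V \<otimes>\<^bsub>B\<lparr>carrier := A\<rparr>\<^esub> (W \<otimes>\<^bsub>B\<^esub> y) = x \<otimes>\<^bsub>B\<lparr>carrier := A\<rparr>\<^esub> y"
      using AVWA[of x y] AB V W by (simp add: B.mult_assoc B.mult_closed)
  next
    fix h x assume h: "h \<in> carrier H" and "x \<in> carrier (B\<lparr>carrier := A\<rparr>)"
    then have x: "x \<in> carrier B"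
      using AB by simp
    show "W \<otimes>\<^bsub>B\<^esub> lact (B\<lparr>carrier := A\<rparr>) h x = lact (B\<lparr>carrier := A\<rparr>) h (W \<otimes>\<^bsub>B\<^esub> x)"
      using h x W by (simp add: B.mult_balanced[symmetric] hW[symmetric] B.mult_lact)
    show "ract (B\<lparr>carrier := A\<rparr>) x h \<otimes>\<^bsub>B\<^esub> V = ract (B\<lparr>carrier := A\<rparr>) (x \<otimes>\<^bsub>B\<^esub> V) h"
      using h x V by (simp add: B.mult_balanced hV B.mult_ract)
  qed (use AB V W WA AV in \<open>simp_all add: B.mult_assoc B.mult_add_left B.mult_add_right
      B.mult_lact B.mult_ract\<close>)
qed

theorem proposition5p1p2:
  fixes H :: "'h ring" and cen :: bool
    and D :: "('p, 'n) category"
    and Eo :: "('h, 'u) halg \<Rightarrow> 'p"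
    and Em :: "('h, 'u) halg \<Rightarrow> ('h, 'u) halg \<Rightarrow> ('u \<Rightarrow> 'u) \<Rightarrow> 'n"
    and B :: "('h, 'u) halg" and A :: "'u set" and V W :: 'u
  assumes "infinite (UNIV :: 'u set)"
    and "ring H"
    and "cen \<Longrightarrow> cring H"
    and "abelian_category D"
    and "covariant_functor (Alg H cen) D Eo Em"
    and "M2_stable H cen D Eo Em"
    and "H_algebra H B"
    and "H_subalgebra H A B"
    and "cen \<Longrightarrow> central H (B\<lparr>carrier := A\<rparr>)"
    and "V \<in> carrier B" and "W \<in> carrier B"
    and "\<And>a. a \<in> A \<Longrightarrow> W \<otimes>\<^bsub>B\<^esub> a \<in> A"
    and "\<And>a. a \<in> A \<Longrightarrow> a \<otimes>\<^bsub>B\<^esub> V \<in> A"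
    and "\<And>a a'. \<lbrakk>a \<in> A; a' \<in> A\<rbrakk> \<Longrightarrow> a \<otimes>\<^bsub>B\<^esub> V \<otimes>\<^bsub>B\<^esub> W \<otimes>\<^bsub>B\<^esub> a' = a \<otimes>\<^bsub>B\<^esub> a'"
    and "\<And>h. h \<in> carrier H \<Longrightarrow> lact B h V = ract B V h"
    and "\<And>h. h \<in> carrier H \<Longrightarrow> lact B h W = ract B W h"
  shows "phi B A V W \<in> H_alg_hom H (B\<lparr>carrier := A\<rparr>) (B\<lparr>carrier := A\<rparr>)
    \<and> Em (B\<lparr>carrier := A\<rparr>) (B\<lparr>carrier := A\<rparr>) (phi B A V W) = ident D (Eo (B\<lparr>carrier := A\<rparr>))"
proof -
  let ?A = "B\<lparr>carrier := A\<rparr>"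
  interpret A: multiplier_pair H ?A "\<lambda>a. W \<otimes>\<^bsub>B\<^esub> a" "\<lambda>a. a \<otimes>\<^bsub>B\<^esub> V"
    using assms(7,8,10-16) by (rule multiplier_pair_of_elements)
  have "W \<otimes>\<^bsub>B\<^esub> a \<otimes>\<^bsub>B\<^esub> V = W \<otimes>\<^bsub>B\<^esub> (a \<otimes>\<^bsub>B\<^esub> V)" if "a \<in> A" for a
    using A.l_r that by simp
  then have "phi B A V W = A.sandwich"
    by (auto simp: phi_def A.sandwich_def)
  moreover have "category D"
    using assms(4) by (rule abelian_category.axioms(1))
  ultimately show ?thesis
    using A.sandwich_hom A.M2_stable_sandwich[OF assms(1,9) _ assms(5,6)] by simp
qed

end
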